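(* Let $R=\langle s,r_1,r_2,\ldots\rangle$ and $a$ be as in the context. Then $a(n)=0$ for $n<s$, and for every $n\ge s$, $$a(n)=n-s-\sum_{i,j\ge 1}c_{i,j}\,a^{i}(n-j),$$ where $a^i$ denotes the $i$-fold composition of $a$, $r_{i,j}=1$ if $r_i\ge j$ and $r_{i,j}=0$ otherwise (for $i,j\ge0$, with the convention $r_0=-1$), and $c_{i,j}=r_{i,j}-r_{i-1,j}$.
   Context: Let $R=\langle s,r_1,r_2,\ldots\rangle$ be a sequence of nonnegative integers with $s\ge 1$. Let $\Sigma=\{\mathtt r,\mathtt 0,\mathtt 1,\mathtt 2,\ldots\}$ be the infinite alphabet consisting of a letter $\mathtt r$ together with a letter $[j]$ for each integer $j\ge 0$. For a letter $\mathtt x$ and $m\ge0$, $\mathtt x^m$ is the word of $m$ copies of $\mathtt x$. Let $\sigma$ be the morphism of words over $\Sigma$ defined by $\sigma(\mathtt r)=\mathtt r\,\mathtt 0^{s}$ and $\sigma([j])=[j+1]\,\mathtt 0^{r_{j+1}}$ for $j\ge 0$. Let $\mathcal T$ be the infinite rooted ordered tree whose root is labelled $\mathtt r$ and in which the labels of the children of any node labelled $\mathtt x$, read left to right, spell $\sigma(\mathtt x)$. For a node $v$, $\ell(v)$ is the number of nodes in the same row (depth) as $v$ lying strictly to its left. Define $a:\mathbb Z\to\mathbb Z_{\ge0}$ by $a(n)=0$ for $n<0$ and $a(\ell(v))=\ell(\mathrm{parent}(v))$ for every non-root node $v$ of $\mathcal T$ (this is well defined). *)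

theory Defs
  imports "HOL-Analysis.Infinite_Sum"
begin

text \<open>
  The sequence \<open>R = \<langle>s, r\<^sub>1, r\<^sub>2, \<dots>\<rangle>\<close> is given by a number \<open>s\<close> and a function \<open>r\<close>, whose
  value \<open>r 0\<close> is never used.
\<close>

datatype letter = Root | Letter nat

fun sigma :: "nat \<Rightarrow> (nat \<Rightarrow> nat) \<Rightarrow> letter \<Rightarrow> letter list" where
  "sigma s r Root = Root # replicate s (Letter 0)"
| "sigma s r (Letter j) = Letter (Suc j) # replicate (r (Suc j)) (Letter 0)"

text \<open>
  A node of the tree is represented by its address: the list of (zero-based) child positions on
  the path leading from the root to the node. Hence the root is \<open>[]\<close>, the depth of a node is its
  \<open>length\<close>, and the parent of a non-root node \<open>v\<close> is \<open>butlast v\<close>.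
\<close>

definition label :: "nat \<Rightarrow> (nat \<Rightarrow> nat) \<Rightarrow> nat list \<Rightarrow> letter" where
  "label s r v = foldl (\<lambda>x k. sigma s r x ! k) Root v"

inductive_set nodes :: "nat \<Rightarrow> (nat \<Rightarrow> nat) \<Rightarrow> nat list set" for s r where
  root: "[] \<in> nodes s r"
| child: "v \<in> nodes s r \<Longrightarrow> k < length (sigma s r (label s r v)) \<Longrightarrow> v @ [k] \<in> nodes s r"

text \<open>
  Within one row the left-to-right order is the lexicographic order on addresses; \<^const>\<open>lex\<close>
  relates only lists of equal length.
\<close>

definition ell :: "nat \<Rightarrow> (nat \<Rightarrow> nat) \<Rightarrow> nat list \<Rightarrow> nat" where
  "ell s r v = card {u \<in> nodes s r. (u, v) \<in> lex less_than}"

definition is_parent_fun :: "nat \<Rightarrow> (nat \<Rightarrow> nat) \<Rightarrow> (int \<Rightarrow> int) \<Rightarrow> bool" where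
  "is_parent_fun s r a \<longleftrightarrow>
     (\<forall>n<0. a n = 0) \<and>
     (\<forall>v\<in>nodes s r. v \<noteq> [] \<longrightarrow> a (int (ell s r v)) = int (ell s r (butlast v)))"

text \<open>
  For \<open>s \<ge> 1\<close> exactly one function satisfies \<open>is_parent_fun s r\<close>; see \<open>ex1_is_parent_fun\<close> below.
\<close>

definition parent_fun :: "nat \<Rightarrow> (nat \<Rightarrow> nat) \<Rightarrow> int \<Rightarrow> int" where
  "parent_fun s r = (THE a. is_parent_fun s r a)"

text \<open>The convention \<open>r\<^sub>0 = -1\<close> makes \<open>r_ind r 0 j = 0\<close> for all \<open>j\<close>.\<close>

definition r_ind :: "(nat \<Rightarrow> nat) \<Rightarrow> nat \<Rightarrow> nat \<Rightarrow> int" where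
  "r_ind r i j = (if (if i = 0 then -1 else int (r i)) \<ge> int j then 1 else 0)"

text \<open>Only used for \<open>i \<ge> 1\<close>, so the subtraction \<open>i - 1\<close> does not truncate.\<close>

definition c_coeff :: "(nat \<Rightarrow> nat) \<Rightarrow> nat \<Rightarrow> nat \<Rightarrow> int" where
  "c_coeff r i j = r_ind r i j - r_ind r (i - 1) j"


text \<open>
  Well-definedness. The leftmost child of the root is again labelled \<open>Root\<close>, so \<open>(#) 0\<close> embeds
  the tree into itself, preserving labels and \<open>ell\<close> and increasing depth by one.
\<close>

lemma label_Nil [simp]: "label s r [] = Root"
  by (simp add: label_def)

lemma label_Cons0 [simp]: "label s r (0 # v) = label s r v"
  by (simp add: label_def)

lemma sigma_nonempty: "length (sigma s r x) > 0"
  by (cases x) auto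

lemma nodes_snoc_iff:
  "v @ [k] \<in> nodes s r \<longleftrightarrow> v \<in> nodes s r \<and> k < length (sigma s r (label s r v))"
  by (auto elim: nodes.cases intro: nodes.child)

lemma Cons0_nodes_iff [simp]: "0 # v \<in> nodes s r \<longleftrightarrow> v \<in> nodes s r"
proof (induction v rule: rev_induct)
  case Nil
  have "[] @ [0] \<in> nodes s r"
    by (rule nodes.child) (auto intro: nodes.root)
  then show ?case by (auto intro: nodes.root)
next
  case (snoc k v)
  have "(0 # v) @ [k] \<in> nodes s r \<longleftrightarrow> v @ [k] \<in> nodes s r"
    unfolding nodes_snoc_iff using snoc by simp
  then show ?case by simp
qed

definition row :: "nat \<Rightarrow> (nat \<Rightarrow> nat) \<Rightarrow> nat \<Rightarrow> nat list set" where
  "row s r d = {v \<in> nodes s r. length v = d}"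

lemma row_Suc:
  "row s r (Suc d) = (\<Union>v\<in>row s r d. (\<lambda>k. v @ [k]) ` {..<length (sigma s r (label s r v))})"
  (is "?L = ?R")
proof
  show "?L \<subseteq> ?R"
  proof
    fix w assume w: "w \<in> ?L"
    then have "w \<noteq> []" by (auto simp: row_def)
    then obtain v k where "w = v @ [k]" by (metis rev_exhaust)
    with w show "w \<in> ?R" by (auto simp: row_def nodes_snoc_iff)
  qed
  show "?R \<subseteq> ?L" by (auto simp: row_def nodes_snoc_iff)
qed

lemma finite_row: "finite (row s r d)"
proof (induction d)
  case 0
  have "row s r 0 \<subseteq> {[]}" by (auto simp: row_def)
  then show ?case by (rule finite_subset) simp
next
  case (Suc d)
  then show ?case unfolding row_Suc by auto
qed

lemma ell_row: "ell s r v = card {u \<in> row s r (length v). (u, v) \<in> lex less_than}"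
  unfolding ell_def row_def
  by (rule arg_cong[where f = card]) (auto simp: lex_conv)

lemma ell_Cons0 [simp]: "ell s r (0 # v) = ell s r v"
proof -
  have "{u \<in> nodes s r. (u, 0 # v) \<in> lex less_than}
      = (#) 0 ` {u \<in> nodes s r. (u, v) \<in> lex less_than}" (is "?L = ?R")
  proof
    show "?L \<subseteq> ?R"
    proof
      fix u assume u: "u \<in> ?L"
      then obtain x u' where "u = x # u'" by (cases u) auto
      with u show "u \<in> ?R" by auto
    qed
  qed auto
  then show ?thesis unfolding ell_def by (simp add: card_image)
qed

lemma lex_less_than_total:
  assumes "length u = length v" "u \<noteq> v"
  shows "(u, v) \<in> lex less_than \<or> (v, u) \<in> lex less_than"
  using assms by (induction u v rule: list_induct2) auto

lemma lex_less_than_irrefl: "(u, u) \<notin> lex (less_than :: (nat \<times> nat) set)"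
  by (induction u) auto

lemma lex_less_than_trans:
  "(u, v) \<in> lex less_than \<Longrightarrow> (v, w) \<in> lex less_than \<Longrightarrow> (u, w) \<in> lex (less_than :: (nat \<times> nat) set)"
  using lex_transI[of less_than] by (meson transD trans_less_than)

lemma ell_less:
  assumes "u \<in> nodes s r" "(u, v) \<in> lex less_than"
  shows "ell s r u < ell s r v"
proof -
  have len: "length u = length v" using assms(2) by (simp add: lex_conv)
  show ?thesis unfolding ell_row len
  proof (rule psubset_card_mono)
    show "finite {w \<in> row s r (length v). (w, v) \<in> lex less_than}"
      using finite_row by simp
    have "u \<in> {w \<in> row s r (length v). (w, v) \<in> lex less_than}"
      using assms len by (simp add: row_def)
    then show "{w \<in> row s r (length v). (w, u) \<in> lex less_than}
        \<subset> {w \<in> row s r (length v). (w, v) \<in> lex less_than}"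
      using lex_less_than_irrefl[of u] lex_less_than_trans[OF _ assms(2)] by blast
  qed
qed

lemma inj_on_ell_row: "inj_on (ell s r) (row s r d)"
proof (rule inj_onI)
  fix u v assume *: "u \<in> row s r d" "v \<in> row s r d" "ell s r u = ell s r v"
  show "u = v"
  proof (rule ccontr)
    assume "u \<noteq> v"
    with * have "(u, v) \<in> lex less_than \<or> (v, u) \<in> lex less_than"
      by (intro lex_less_than_total) (auto simp: row_def)
    with * ell_less[of u s r v] ell_less[of v s r u] show False by (auto simp: row_def)
  qed
qed

lemma ell_image_row: "ell s r ` row s r d = {..<card (row s r d)}"
proof (rule card_subset_eq)
  show "ell s r ` row s r d \<subseteq> {..<card (row s r d)}"
  proof clarsimp
    fix v assume v: "v \<in> row s r d"
    then have "{u \<in> row s r (length v). (u, v) \<in> lex less_than} \<subset> row s r d"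
      using lex_less_than_irrefl[of v] by (auto simp: row_def)
    then show "ell s r v < card (row s r d)"
      unfolding ell_row using finite_row by (intro psubset_card_mono)
  qed
  show "card (ell s r ` row s r d) = card {..<card (row s r d)}"
    by (simp add: card_image inj_on_ell_row)
qed simp

lemma card_row:
  assumes "s \<ge> 1"
  shows "card (row s r d) > d"
proof (induction d)
  case 0
  have "[] \<in> row s r 0" by (simp add: row_def nodes.root)
  then show ?case using finite_row card_gt_0_iff by blast
next
  case (Suc d)
  have "\<exists>w. length w = d \<and> 1 # w \<in> nodes s r"
  proof (induction d)
    case 0
    have "[] @ [1] \<in> nodes s r"
      by (rule nodes.child) (use assms in \<open>auto intro: nodes.root\<close>)
    then show ?case by simp
  next
    case (Suc d)
    then obtain w where "length w = d" "1 # w \<in> nodes s r" by blast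
    then show ?case
      using nodes.child[of "1 # w" s r 0] sigma_nonempty by (intro exI[of _ "w @ [0]"]) simp
  qed
  then obtain w where w: "1 # w \<in> row s r (Suc d)" by (auto simp: row_def)
  have "insert (1 # w) ((#) 0 ` row s r d) \<subseteq> row s r (Suc d)"
    using w by (auto simp: row_def)
  then have "card (insert (1 # w) ((#) 0 ` row s r d)) \<le> card (row s r (Suc d))"
    using finite_row by (rule card_mono[rotated])
  moreover have "card (insert (1 # w) ((#) 0 ` row s r d)) = Suc (card (row s r d))"
    using finite_row by (subst card_insert_disjoint) (auto simp: card_image)
  ultimately show ?case using Suc by simp
qed

lemma ell_butlast_pad:
  assumes "v \<in> nodes s r" "v \<noteq> []"
  shows "replicate m 0 @ v \<in> nodes s r \<and> ell s r (replicate m 0 @ v) = ell s r v \<and>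
         ell s r (butlast (replicate m 0 @ v)) = ell s r (butlast v)"
  using assms by (induction m) auto

lemma ell_butlast_cong:
  assumes "v \<in> nodes s r" "v \<noteq> []" "w \<in> nodes s r" "w \<noteq> []" "ell s r v = ell s r w"
  shows "ell s r (butlast v) = ell s r (butlast w)"
proof -
  let ?v = "replicate (length w) 0 @ v" and ?w = "replicate (length v) 0 @ w"
  note pv = ell_butlast_pad[OF assms(1,2), of "length w"]
  note pw = ell_butlast_pad[OF assms(3,4), of "length v"]
  have "?v = ?w"
    using pv pw assms(5)
    by (intro inj_onD[OF inj_on_ell_row[of s r "length v + length w"]]) (auto simp: row_def)
  with pv pw show ?thesis by metis
qed

lemma ell_surj:
  assumes "s \<ge> 1"
  shows "\<exists>v\<in>nodes s r. v \<noteq> [] \<and> ell s r v = n"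
proof -
  have "n \<in> ell s r ` row s r (Suc n)"
    unfolding ell_image_row using card_row[OF assms, of "Suc n" r] by simp
  then obtain v where "v \<in> row s r (Suc n)" "ell s r v = n" by blast
  then show ?thesis by (intro bexI[of _ v]) (auto simp: row_def)
qed

lemma ex1_is_parent_fun:
  assumes "s \<ge> 1"
  shows "\<exists>!a. is_parent_fun s r a"
proof (rule ex_ex1I)
  define f where "f n = (SOME v. v \<in> nodes s r \<and> v \<noteq> [] \<and> ell s r v = n)" for n
  have f: "f n \<in> nodes s r \<and> f n \<noteq> [] \<and> ell s r (f n) = n" for n
    unfolding f_def by (rule someI_ex) (use ell_surj[OF assms, of r n] in blast)
  define a where "a n = (if n < 0 then 0 else int (ell s r (butlast (f (nat n)))))" for n :: int
  have "is_parent_fun s r a"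
    unfolding is_parent_fun_def
  proof (intro conjI ballI allI impI)
    fix v assume v: "v \<in> nodes s r" "v \<noteq> []"
    have "ell s r (butlast (f (ell s r v))) = ell s r (butlast v)"
      by (rule ell_butlast_cong) (use v f in auto)
    then show "a (int (ell s r v)) = int (ell s r (butlast v))"
      by (simp add: a_def)
  qed (simp add: a_def)
  then show "\<exists>a. is_parent_fun s r a" by blast
next
  fix a b assume ab: "is_parent_fun s r a" "is_parent_fun s r b"
  show "a = b"
  proof
    fix n :: int
    show "a n = b n"
    proof (cases "n < 0")
      case True
      with ab show ?thesis by (simp add: is_parent_fun_def)
    next
      case False
      obtain v where v: "v \<in> nodes s r" "v \<noteq> []" "ell s r v = nat n"
        using ell_surj[OF assms, of r "nat n"] by blast
      have "a (int (ell s r v)) = b (int (ell s r v))"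
        using ab v(1,2) by (simp add: is_parent_fun_def)
      then show ?thesis using v(3) False by simp
    qed
  qed
qed

lemma is_parent_fun_parent_fun: "s \<ge> 1 \<Longrightarrow> is_parent_fun s r (parent_fun s r)"
  unfolding parent_fun_def by (rule theI'[OF ex1_is_parent_fun])

end

theory Submission
  imports Defs
begin

text \<open>
  All rows of the tree are prefixes of one infinite word, so a node may be identified with its
  position. Every position has exactly one first child, and the other children carry the letter
  \<open>[0]\<close>, so among the positions \<open>1, \<dots>, n\<close> there are \<open>a n\<close> first children and \<open>n - a n\<close> letters
  \<open>[0]\<close>. Passing to parents, the
  number of letters \<open>[i]\<close> at positions \<open>\<le> m\<close> is \<open>a\<^sup>i m - a\<^sup>i\<^sup>+\<^sup>1 m\<close>. On the other hand, apart from
  the \<open>s\<close> children of the root, the letters \<open>[0]\<close> at positions \<open>\<le> n\<close> are found \<open>j\<close> places to the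
  right of a letter \<open>[i]\<close> with \<open>i \<ge> 1\<close> and \<open>1 \<le> j \<le> r\<^sub>i\<close>. Comparing the two counts and summing by
  parts gives the recurrence.
\<close>

section \<open>Positions in the limit word\<close>

lemma snoc_in_lex_iff: "(u @ [i], v @ [k]) \<in> lex R \<longleftrightarrow> (u, v) \<in> lex R \<or> u = v \<and> (i, k) \<in> R"
proof (induction u arbitrary: v)
  case Nil
  then show ?case by (cases v) auto
next
  case (Cons x u)
  then show ?case by (cases v) auto
qed

lemma ell_pad:
  assumes "v \<in> nodes s r"
  shows "replicate m 0 @ v \<in> nodes s r \<and> ell s r (replicate m 0 @ v) = ell s r v \<and>
         label s r (replicate m 0 @ v) = label s r v"
  using assms by (induction m) auto

text \<open>Prefixing zeros keeps \<open>ell\<close> and \<open>label\<close> and can bring both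
  nodes into a common row, where \<open>ell\<close> is injective. This makes \<open>lab\<close>
  independent of the chosen node.\<close>

lemma ell_label_cong:
  assumes "v \<in> nodes s r" "w \<in> nodes s r" "ell s r v = ell s r w"
  shows "label s r v = label s r w"
proof -
  let ?v = "replicate (length w) 0 @ v" and ?w = "replicate (length v) 0 @ w"
  note pv = ell_pad[OF assms(1), of "length w"]
  note pw = ell_pad[OF assms(2), of "length v"]
  have "?v = ?w"
    using pv pw assms(3)
    by (intro inj_onD[OF inj_on_ell_row[of s r "length v + length w"]]) (auto simp: row_def)
  with pv pw show ?thesis by metis
qed

definition lab :: "nat \<Rightarrow> (nat \<Rightarrow> nat) \<Rightarrow> nat \<Rightarrow> letter" where
  "lab s r n = label s r (SOME v. v \<in> nodes s r \<and> ell s r v = n)"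

text \<open>The children of all nodes at positions below \<open>n\<close> precede those of the node
  at \<open>n\<close>, so the leftmost child of the latter has this position.\<close>

definition first_child :: "nat \<Rightarrow> (nat \<Rightarrow> nat) \<Rightarrow> nat \<Rightarrow> nat" where
  "first_child s r n = (\<Sum>i<n. length (sigma s r (lab s r i)))"

lemma lab_ell:
  assumes "v \<in> nodes s r"
  shows "lab s r (ell s r v) = label s r v"
proof -
  let ?w = "SOME w. w \<in> nodes s r \<and> ell s r w = ell s r v"
  have "?w \<in> nodes s r \<and> ell s r ?w = ell s r v"
    by (rule someI[of _ v]) (use assms in simp)
  then show ?thesis
    unfolding lab_def using ell_label_cong assms by blast
qed

lemma label_snoc: "label s r (v @ [k]) = sigma s r (label s r v) ! k"
  by (simp add: label_def)

text \<open>To the left of \<open>v @ [k]\<close> lie exactly the children of the nodes left of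
  \<open>v\<close> and the \<open>k\<close> earlier siblings.\<close>

lemma ell_snoc:
  assumes "v @ [k] \<in> nodes s r"
  shows "ell s r (v @ [k]) = first_child s r (ell s r v) + k"
proof -
  define P where "P = {u \<in> nodes s r. (u, v) \<in> lex less_than}"
  let ?len = "\<lambda>u. length (sigma s r (label s r u))"
  have v: "v \<in> nodes s r" "k < ?len v"
    using assms by (auto simp: nodes_snoc_iff)
  have P_row: "P \<subseteq> row s r (length v)"
    by (auto simp: P_def row_def lex_conv)
  then have fin: "finite P" using finite_row finite_subset by blast
  have inj: "inj_on (ell s r) P"
    using inj_on_ell_row P_row inj_on_subset by blast
  \<comment> \<open>An injection of the \<open>ell s r v\<close> elements of \<open>P\<close> into
    as many positions is onto, so a sum over \<open>P\<close> becomes a sum over positions.\<close>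
  have img: "ell s r ` P = {..<ell s r v}"
  proof (rule card_subset_eq)
    show "ell s r ` P \<subseteq> {..<ell s r v}"
      using ell_less by (auto simp: P_def)
    show "card (ell s r ` P) = card {..<ell s r v}"
      using card_image[OF inj] by (simp add: ell_def P_def)
  qed simp
  have eq: "{u \<in> nodes s r. (u, v @ [k]) \<in> lex less_than}
      = (\<Union>u\<in>P. (\<lambda>i. u @ [i]) ` {..<?len u}) \<union> (\<lambda>i. v @ [i]) ` {..<k}" (is "?L = ?A \<union> ?B")
  proof (intro subset_antisym subsetI)
    fix w assume w: "w \<in> ?L"
    then have "w \<noteq> []" by auto
    then obtain u i where "w = u @ [i]" by (metis rev_exhaust)
    with w show "w \<in> ?A \<union> ?B"
      by (auto simp: snoc_in_lex_iff nodes_snoc_iff P_def)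
  qed (use v in \<open>auto simp: snoc_in_lex_iff nodes_snoc_iff P_def\<close>)
  have "card ?A = (\<Sum>u\<in>P. card ((\<lambda>i. u @ [i]) ` {..<?len u}))"
    using fin by (intro card_UN_disjoint) auto
  also have "\<dots> = (\<Sum>u\<in>P. ?len u)"
    by (intro sum.cong refl) (simp add: card_image inj_on_def)
  also have "\<dots> = (\<Sum>u\<in>P. length (sigma s r (lab s r (ell s r u))))"
    by (intro sum.cong refl) (simp add: lab_ell P_def)
  also have "\<dots> = first_child s r (ell s r v)"
    unfolding first_child_def img[symmetric] by (simp add: sum.reindex[OF inj])
  finally have "card ?A = first_child s r (ell s r v)" .
  moreover have "card ?B = k" by (simp add: card_image inj_on_def)
  moreover have "?A \<inter> ?B = {}"
    using lex_less_than_irrefl by (auto simp: P_def)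
  ultimately show ?thesis
    unfolding ell_def[of s r "v @ [k]"] eq using fin by (simp add: card_Un_disjoint)
qed

text \<open>What the counting uses of the tree: \<open>x\<close> is the limit word, fixed by the
  morphism, \<open>b p\<close> is where the block of children of \<open>p\<close> starts, and
  \<open>a\<close> sends a position to its parent's.\<close>

locale limit_word =
  fixes s :: nat and r :: "nat \<Rightarrow> nat"
    and x :: "nat \<Rightarrow> letter" and b a :: "nat \<Rightarrow> nat"
  assumes s_pos: "s \<ge> 1"
    and x_0: "x 0 = Root"
    and b_0: "b 0 = 0"
    and b_Suc: "b (Suc p) = b p + length (sigma s r (x p))"
    and x_child: "k < length (sigma s r (x p)) \<Longrightarrow> x (b p + k) = sigma s r (x p) ! k"
    and a_child: "k < length (sigma s r (x p)) \<Longrightarrow> a (b p + k) = p"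

lemma limit_word_parent_fun:
  assumes "s \<ge> 1"
  shows "limit_word s r (lab s r) (first_child s r) (\<lambda>n. nat (parent_fun s r (int n)))"
proof
  show "lab s r 0 = Root"
    using lab_ell[OF nodes.root, of s r] by (simp add: ell_def)
next
  fix k p assume k: "k < length (sigma s r (lab s r p))"
  obtain v where v: "v \<in> nodes s r" "ell s r v = p"
    using ell_surj[OF assms] by blast
  have vk: "v @ [k] \<in> nodes s r"
    using v k lab_ell[OF v(1)] by (simp add: nodes_snoc_iff)
  have pos: "ell s r (v @ [k]) = first_child s r p + k"
    using ell_snoc[OF vk] v by simp
  show "lab s r (first_child s r p + k) = sigma s r (lab s r p) ! k"
    using lab_ell[OF vk] lab_ell[OF v(1)] by (simp add: pos v label_snoc)
  show "nat (parent_fun s r (int (first_child s r p + k))) = p"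
    using is_parent_fun_parent_fun[OF assms, of r] vk pos v(2)
    unfolding is_parent_fun_def by fastforce
qed (use assms in \<open>simp_all add: first_child_def\<close>)

section \<open>Counting letters\<close>

context limit_word
begin

section \<open>Blocks of siblings and the letters in them\<close>

lemma b_strict_mono: "strict_mono b"
  using sigma_nonempty by (simp add: strict_mono_Suc_iff b_Suc)

text \<open>The blocks are nonempty, start at 0 and abut, so they tile the positions.\<close>

lemma position_cases:
  obtains p k where "n = b p + k" "k < length (sigma s r (x p))"
proof -
  have "\<exists>p k. n = b p + k \<and> k < length (sigma s r (x p))"
  proof (induction n)
    case 0
    then show ?case using b_0 sigma_nonempty by (intro exI[of _ 0]) auto
  next
    case (Suc n)
    then obtain p k where pk: "n = b p + k" "k < length (sigma s r (x p))" by blast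
    show ?case
    proof (cases "Suc k < length (sigma s r (x p))")
      case True
      with pk show ?thesis by (intro exI[of _ p] exI[of _ "Suc k"]) simp
    next
      case False
      with pk have "Suc n = b (Suc p) + 0" by (simp add: b_Suc)
      then show ?thesis using sigma_nonempty by blast
    qed
  qed
  then show ?thesis using that by blast
qed

text \<open>The block containing \<open>n\<close> has index \<open>a n\<close>. This Galois
  connection between \<open>b\<close> and \<open>a\<close> turns a bound on first children into a
  bound on their parents.\<close>

lemma b_le_iff: "b p \<le> n \<longleftrightarrow> p \<le> a n"
proof -
  obtain q k where q: "n = b q + k" "k < length (sigma s r (x q))"
    by (rule position_cases)
  then have "a n = q" "b q \<le> n" "n < b (Suc q)" by (simp_all add: a_child b_Suc)
  then show ?thesis
    using strict_mono_less_eq[OF b_strict_mono] strict_mono_less[OF b_strict_mono]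
    by (metis less_Suc_eq_le order_le_less_trans order_trans)
qed

lemma sigma_nth_Root:
  "k < length (sigma s r y) \<Longrightarrow> sigma s r y ! k = Root \<longleftrightarrow> k = 0 \<and> y = Root"
  by (cases y; cases k) auto

lemma sigma_nth_Letter_Suc:
  "k < length (sigma s r y) \<Longrightarrow> sigma s r y ! k = Letter (Suc i) \<longleftrightarrow> k = 0 \<and> y = Letter i"
  by (cases y; cases k) auto

lemma sigma_nth_Letter_0:
  "k < length (sigma s r y) \<Longrightarrow> sigma s r y ! k = Letter 0 \<longleftrightarrow> k > 0"
  by (cases y; cases k) auto

lemma x_Letter_Suc_iff: "x q = Letter (Suc i) \<longleftrightarrow> (\<exists>p. q = b p \<and> x p = Letter i)"
proof
  assume "x q = Letter (Suc i)"
  moreover obtain p k where "q = b p + k" "k < length (sigma s r (x p))"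
    by (rule position_cases)
  ultimately show "\<exists>p. q = b p \<and> x p = Letter i"
    by (auto simp: x_child sigma_nth_Letter_Suc)
next
  assume "\<exists>p. q = b p \<and> x p = Letter i"
  then show "x q = Letter (Suc i)" using x_child[of 0] by auto
qed

lemma x_Letter_0_iff: "x q = Letter 0 \<longleftrightarrow> q \<notin> range b"
proof -
  obtain p k where q: "q = b p + k" "k < length (sigma s r (x p))"
    by (rule position_cases)
  have "k > 0 \<longleftrightarrow> q \<notin> range b"
  proof
    assume "k > 0"
    show "q \<notin> range b"
    proof
      assume "q \<in> range b"
      then obtain p' where p': "q = b p'" by blast
      then have "a q = p'"
        using a_child[of 0 p'] sigma_nonempty by simp
      moreover have "a q = p" using a_child[OF q(2)] q(1) by simp
      ultimately show False using p' q(1) \<open>k > 0\<close> by simp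
    qed
  qed (use q in auto)
  then show ?thesis using q by (simp add: x_child sigma_nth_Letter_0)
qed

lemma x_Root_iff: "x q = Root \<longleftrightarrow> q = 0"
proof (induction q rule: less_induct)
  case (less q)
  obtain p k where q: "q = b p + k" "k < length (sigma s r (x p))"
    by (rule position_cases)
  show ?case
  proof
    assume "x q = Root"
    then have k: "k = 0" "x p = Root"
      using q by (simp_all add: x_child sigma_nth_Root)
    have "p = 0"
    proof (rule ccontr)
      assume "p \<noteq> 0"
      \<comment> \<open>The root has at least two children, so first children of later positions
        move strictly right; hence the induction hypothesis applies to \<open>p\<close>.\<close>
      have "b (Suc m) > Suc m" for m
      proof (induction m)
        case 0
        then show ?case using s_pos by (simp add: b_Suc b_0 x_0)
      next
        case (Suc m)
        then show ?case
          using strict_monoD[OF b_strict_mono, of "Suc m" "Suc (Suc m)"] by simp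
      qed
      then have "p < q" using q k \<open>p \<noteq> 0\<close> by (cases p) auto
      with less k \<open>p \<noteq> 0\<close> show False by blast
    qed
    with q k show "q = 0" by (simp add: b_0)
  qed (simp add: x_0)
qed

section \<open>Letter counts of prefixes and iterates of \<open>a\<close>\<close>

definition count :: "nat \<Rightarrow> nat \<Rightarrow> nat" where
  "count i n = card {q. q \<le> n \<and> x q = Letter i}"

text \<open>Taking first children is a bijection from the letters \<open>[i]\<close> at positions up
  to \<open>a n\<close> onto the letters \<open>[i+1]\<close> up to \<open>n\<close>.\<close>

lemma count_Suc: "count (Suc i) n = count i (a n)"
proof -
  have "{q. q \<le> n \<and> x q = Letter (Suc i)} = b ` {p. p \<le> a n \<and> x p = Letter i}"
    by (auto simp: x_Letter_Suc_iff b_le_iff)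
  then show ?thesis
    unfolding count_def
    using strict_mono_imp_inj_on[OF b_strict_mono] by (simp add: card_image)
qed

text \<open>The \<open>n + 1\<close> positions from 0 to \<open>n\<close> split into letters
  \<open>[0]\<close> and the first children \<open>b 0, ..., b (a n)\<close>; the extra ones
  cancel.\<close>

lemma count_0: "count 0 n + a n = n"
proof -
  have "{..n} = {q. q \<le> n \<and> x q = Letter 0} \<union> b ` {..a n}"
    by (auto simp: x_Letter_0_iff b_le_iff[symmetric])
  moreover have "card ({q. q \<le> n \<and> x q = Letter 0} \<union> b ` {..a n})
      = card {q. q \<le> n \<and> x q = Letter 0} + card (b ` {..a n})"
    by (rule card_Un_disjoint) (auto simp: x_Letter_0_iff)
  moreover have "card (b ` {..a n}) = Suc (a n)"
    using strict_mono_imp_inj_on[OF b_strict_mono] by (simp add: card_image)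
  ultimately have "card {..n} = count 0 n + Suc (a n)"
    by (simp add: count_def)
  then show ?thesis by simp
qed

lemma count_eq: "int (count i n) = int ((a ^^ i) n) - int ((a ^^ Suc i) n)"
proof (induction i arbitrary: n)
  case 0
  then show ?case using count_0[of n] by simp
next
  case (Suc i)
  then show ?case by (simp add: count_Suc funpow_swap1)
qed

lemma root_children: "q \<le> s \<Longrightarrow> a q = 0" "1 \<le> q \<Longrightarrow> q \<le> s \<Longrightarrow> x q = Letter 0"
  using a_child[of q 0] x_child[of q 0] by (auto simp: x_0 b_0 nth_Cons')

lemma a_less:
  assumes "n \<ge> 1"
  shows "a n < n"
proof -
  have "1 \<in> {q. q \<le> n \<and> x q = Letter 0}"
    using assms s_pos root_children(2)[of 1] by simp
  then have "count 0 n > 0"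
    unfolding count_def by (subst card_gt_0_iff) auto
  then show ?thesis using count_0[of n] by simp
qed

text \<open>By \<open>a_less\<close> each application lowers a positive value by at least one, and 0
  is fixed. This truncates the infinite sum.\<close>

lemma funpow_a_eq_0: "n \<le> i \<Longrightarrow> (a ^^ i) n = 0"
proof (induction i arbitrary: n)
  case (Suc i)
  have "a n \<le> i"
    using a_less[of n] Suc.prems root_children(1)[of 0] by (cases n) auto
  then show ?case using Suc.IH by (simp add: funpow_swap1)
qed simp

text \<open>A \<open>[0]\<close> beyond position \<open>s\<close> is identified by the first child
  \<open>p\<close> of its block, the letter \<open>[i]\<close> at \<open>p\<close>, and its distance
  \<open>j\<close> from \<open>p\<close>; \<open>S\<close> collects these triples.\<close>

lemma count_0_eq_sum:
  assumes "n \<ge> s"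
  shows "count 0 n =
    s + (\<Sum>(i, j) | i \<in> {1..n} \<and> j \<in> {1..n} \<and> j \<le> r i. count i (n - j))"
proof -
  let ?I = "{(i, j). i \<in> {1..n} \<and> j \<in> {1..n} \<and> j \<le> r i}"
  define S where "S = (SIGMA (i, j):?I. {p. p \<le> n - j \<and> x p = Letter i})"
  define Z where "Z = {q. s < q \<and> q \<le> n \<and> x q = Letter 0}"
  have finI: "finite ?I"
    by (rule finite_subset[of _ "{1..n} \<times> {1..n}"]) auto
  have "bij_betw (\<lambda>((i, j), p). p + j) S Z"
    unfolding bij_betw_def
  proof
    \<comment> \<open>The block of a letter \<open>[i-1]\<close> is \<open>[i]\<close> followed by
      \<open>r i\<close> zeros, so \<open>p + j\<close> still lies in the block that starts at
      \<open>p\<close>.\<close>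
    have parent: "\<exists>p'. p = b p' \<and> j < length (sigma s r (x p')) \<and> j > 0 \<and> p' > 0 \<and> x p' = Letter (i - 1)"
      if "((i, j), p) \<in> S" for i j p
    proof -
      from that have "x p = Letter (Suc (i - 1))" and *: "1 \<le> i" "1 \<le> j" "j \<le> r i"
        by (auto simp: S_def)
      then obtain p' where "p = b p'" "x p' = Letter (i - 1)"
        unfolding x_Letter_Suc_iff by blast
      with * show ?thesis using x_0 by (intro exI[of _ p']) (auto intro: gr0I)
    qed
    show "inj_on (\<lambda>((i, j), p). p + j) S"
    proof (rule inj_onI)
      fix u v assume uv: "u \<in> S" "v \<in> S" "(\<lambda>((i, j), p). p + j) u = (\<lambda>((i, j), p). p + j) v"
      obtain i j p i' j' p' where u: "u = ((i, j), p)" and v: "v = ((i', j'), p')"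
        by (metis surj_pair)
      with uv have S: "((i, j), p) \<in> S" "((i', j'), p') \<in> S" and eq: "p + j = p' + j'"
        by simp_all
      obtain q q' where q: "p = b q" "j < length (sigma s r (x q))" "x q = Letter (i - 1)"
        and q': "p' = b q'" "j' < length (sigma s r (x q'))" "x q' = Letter (i' - 1)"
        using parent[OF S(1)] parent[OF S(2)] by blast
      have "q = q'"
        using a_child[OF q(2)] a_child[OF q'(2)] eq q(1) q'(1) by simp
      moreover have "1 \<le> i" "1 \<le> i'" using S by (auto simp: S_def)
      ultimately show "u = v" using q q' eq by (simp add: u v)
    qed
    show "(\<lambda>((i, j), p). p + j) ` S = Z"
    proof (intro subset_antisym subsetI)
      fix q assume "q \<in> (\<lambda>((i, j), p). p + j) ` S"
      then obtain i j p where S: "((i, j), p) \<in> S" and q: "q = p + j" by auto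
      obtain p' where p': "p = b p'" "j < length (sigma s r (x p'))" "j > 0" "p' > 0"
        using parent[OF S] by blast
      have "x q = Letter 0" using p' q by (simp add: x_child sigma_nth_Letter_0)
      \<comment> \<open>As \<open>p'\<close> is not the root, its block starts at
        \<open>b 1 = s + 1\<close> or later.\<close>
      moreover have "s < q"
        using strict_mono_less_eq[OF b_strict_mono, of 1 p'] p' q by (simp add: b_Suc b_0 x_0)
      moreover have "q \<le> n" using S q by (auto simp: S_def)
      ultimately show "q \<in> Z" by (simp add: Z_def)
    next
      fix q assume "q \<in> Z"
      then have q: "s < q" "q \<le> n" "x q = Letter 0" by (auto simp: Z_def)
      obtain p k where p: "q = b p + k" "k < length (sigma s r (x p))"
        by (rule position_cases)
      have k: "k > 0" using q p by (simp add: x_child sigma_nth_Letter_0)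
      have "p \<noteq> 0"
      proof
        assume "p = 0"
        with p q(1) show False by (simp add: b_0 x_0)
      qed
      then obtain i where i: "x p = Letter i" using x_Root_iff by (cases "x p") auto
      have xb: "x (b p) = Letter (Suc i)" using i x_Letter_Suc_iff by blast
      \<comment> \<open>The index set bounds the letter by \<open>n\<close>: a letter
        \<open>[i+1]\<close> at \<open>b p\<close> makes the iterate \<open>a ^^ Suc i\<close>
        nonzero there, which forces \<open>Suc i < b p\<close>.\<close>
      have "count (Suc i) (b p) > 0"
        unfolding count_def card_gt_0_iff using xb by auto
      then have "(a ^^ Suc i) (b p) \<noteq> 0"
        using count_eq[of "Suc i" "b p"] by linarith
      then have "Suc i < b p" using funpow_a_eq_0[of "b p" "Suc i"] by force
      then have "((Suc i, k), b p) \<in> S"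
        using p q k i xb by (auto simp: S_def)
      then show "q \<in> (\<lambda>((i, j), p). p + j) ` S"
        using p by force
    qed
  qed
  then have "card Z = card S" by (simp add: bij_betw_same_card)
  also have "\<dots> = (\<Sum>(i, j)\<in>?I. count i (n - j))"
    unfolding S_def using finI by (subst card_SigmaI) (auto simp: count_def intro!: sum.cong)
  finally have Z: "card Z = (\<Sum>(i, j)\<in>?I. count i (n - j))" .
  have "{q. q \<le> n \<and> x q = Letter 0} = {1..s} \<union> Z"
    using assms root_children(2) x_0 unfolding Z_def
    by (auto simp: Suc_le_eq not_less intro: gr0I)
  moreover have "card ({1..s} \<union> Z) = card {1..s} + card Z"
    by (rule card_Un_disjoint) (auto simp: Z_def)
  ultimately show ?thesis unfolding count_def[of 0] using Z by simp
qed

end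

section \<open>The recurrence\<close>

lemma r_ind_pos: "i \<ge> 1 \<Longrightarrow> r_ind r i j = of_bool (j \<le> r i)"
  by (simp add: r_ind_def)

text \<open>Abel summation; the lower boundary term vanishes because the convention
  \<open>r_0 = -1\<close> gives \<open>r_ind r 0 j = 0\<close>.\<close>

lemma sum_c_coeff_by_parts:
  fixes f :: "nat \<Rightarrow> int"
  assumes "j \<ge> 1"
  shows "(\<Sum>i=1..N. c_coeff r i j * f i)
    = (\<Sum>i=1..N. r_ind r i j * (f i - f (Suc i))) + r_ind r N j * f (Suc N)"
proof (induction N)
  case 0
  then show ?case using assms by (simp add: r_ind_def)
next
  case (Suc N)
  then show ?case by (simp add: c_coeff_def algebra_simps)
qed

theorem theorem4:
  fixes s :: nat and r :: "nat \<Rightarrow> nat"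
  assumes "s \<ge> 1"
  shows "(\<forall>n::int. n < int s \<longrightarrow> parent_fun s r n = 0) \<and>
    (\<forall>n::int. n \<ge> int s \<longrightarrow>
      finite {(i, j). i \<ge> 1 \<and> j \<ge> 1 \<and> c_coeff r i j * (parent_fun s r ^^ i) (n - int j) \<noteq> 0} \<and>
      parent_fun s r n =
        n - int s - (\<Sum>\<^sub>\<infinity>(i, j)\<in>{1..} \<times> {1..}. c_coeff r i j * (parent_fun s r ^^ i) (n - int j)))"
proof -
  define A where "A = parent_fun s r"
  define a where "a = (\<lambda>n. nat (A (int n)))"
  interpret limit_word s r "lab s r" "first_child s r" a
    unfolding a_def A_def by (rule limit_word_parent_fun[OF assms])
  have A: "is_parent_fun s r A"
    unfolding A_def by (rule is_parent_fun_parent_fun[OF assms])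
  have A_neg: "A m = 0" if "m < 0" for m
    using A that by (simp add: is_parent_fun_def)
  have A_int: "A (int m) = int (a m)" for m
  proof -
    obtain v where "v \<in> nodes s r" "v \<noteq> []" "ell s r v = m"
      using ell_surj[OF assms] by blast
    with A have "A (int m) \<ge> 0" by (auto simp: is_parent_fun_def)
    then show ?thesis by (simp add: a_def)
  qed
  have pow_int: "(A ^^ i) (int m) = int ((a ^^ i) m)" for i m
    by (induction i) (simp_all add: A_int)
  \<comment> \<open>One application sends a negative number to 0, which \<open>A\<close> fixes; for
    \<open>i = 0\<close> the iterate would be \<open>m\<close> itself.\<close>
  have pow_neg: "(A ^^ i) m = 0" if "m < 0" "i \<ge> 1" for i m
  proof -
    have "A 0 = 0" using A_int[of 0] root_children(1)[of 0] by simp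
    then have "(A ^^ Suc k) m = 0" for k
      by (induction k) (use that A_neg in simp_all)
    with that(2) show ?thesis by (cases i) auto
  qed
  have small: "A n = 0" if "n < int s" for n
  proof (cases "n < 0")
    case False
    with that show ?thesis using A_int[of "nat n"] root_children(1)[of "nat n"] by simp
  qed (rule A_neg)
  have large: "finite {(i, j). i \<ge> 1 \<and> j \<ge> 1 \<and> c_coeff r i j * (A ^^ i) (n - int j) \<noteq> 0} \<and>
      A n = n - int s - (\<Sum>\<^sub>\<infinity>(i, j)\<in>{1..} \<times> {1..}. c_coeff r i j * (A ^^ i) (n - int j))"
    if "n \<ge> int s" for n
  proof -
    define N where "N = nat n"
    have N: "n = int N" "N \<ge> s" using that by (auto simp: N_def)
    let ?t = "\<lambda>i j. c_coeff r i j * (A ^^ i) (n - int j)"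
    have shift: "(A ^^ i) (n - int j) = int ((a ^^ i) (N - j))" if "j \<le> N" for i j
      using that by (simp add: N pow_int flip: of_nat_diff)
    \<comment> \<open>For \<open>j > N\<close> the argument is negative; for \<open>i > N\<close>
      the iterate has already reached 0. Only a finite square of indices remains.\<close>
    have vanish: "?t i j = 0" if "i \<ge> 1" "j \<ge> 1" "i > N \<or> j > N" for i j
    proof (cases "j > N")
      case True
      then show ?thesis using pow_neg[of "n - int j" i] that N by simp
    next
      case False
      then show ?thesis using that shift[of j i] funpow_a_eq_0[of "N - j" i] by simp
    qed
    have "{(i, j). i \<ge> 1 \<and> j \<ge> 1 \<and> ?t i j \<noteq> 0} \<subseteq> {1..N} \<times> {1..N}"
    proof (rule subrelI)
      fix i j assume "(i, j) \<in> {(i, j). i \<ge> 1 \<and> j \<ge> 1 \<and> ?t i j \<noteq> 0}"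
      then have ij: "i \<ge> 1" "j \<ge> 1" "?t i j \<noteq> 0" by blast+
      with vanish[OF ij(1,2)] have "\<not> (i > N \<or> j > N)" by blast
      with ij(1,2) show "(i, j) \<in> {1..N} \<times> {1..N}" by simp
    qed
    then have fin: "finite {(i, j). i \<ge> 1 \<and> j \<ge> 1 \<and> ?t i j \<noteq> 0}"
      by (rule finite_subset) simp
    have "(\<Sum>\<^sub>\<infinity>(i, j)\<in>{1..} \<times> {1..}. ?t i j) = (\<Sum>\<^sub>\<infinity>(i, j)\<in>{1..N} \<times> {1..N}. ?t i j)"
    proof (rule infsum_cong_neutral)
      fix z :: "nat \<times> nat" assume z: "z \<in> {1..} \<times> {1..} - {1..N} \<times> {1..N}"
      obtain i j where ij: "z = (i, j)" by (rule prod.exhaust)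
      with z have "i \<ge> 1" "j \<ge> 1" "i > N \<or> j > N" by auto
      then have "?t i j = 0" by (rule vanish)
      then show "(case z of (i, j) \<Rightarrow> ?t i j) = 0" by (simp only: ij prod.case)
    qed auto
    also have "\<dots> = (\<Sum>(i, j)\<in>{1..N} \<times> {1..N}. ?t i j)"
      by (rule infsum_finite) simp
    also have "\<dots> = (\<Sum>j=1..N. \<Sum>i=1..N. ?t i j)"
      by (simp only: sum.cartesian_product[symmetric]) (rule sum.swap)
    also have "\<dots> = (\<Sum>j=1..N. \<Sum>i=1..N. of_bool (j \<le> r i) * int (count i (N - j)))"
    proof (rule sum.cong)
      fix j assume j: "j \<in> {1..N}"
      \<comment> \<open>This removes the upper boundary term of the summation by parts.\<close>
      have "(A ^^ Suc N) (n - int j) = 0"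
        using j shift[of j "Suc N"] funpow_a_eq_0[of "N - j" "Suc N"] by simp
      then have "(\<Sum>i=1..N. ?t i j)
          = (\<Sum>i=1..N. r_ind r i j * ((A ^^ i) (n - int j) - (A ^^ Suc i) (n - int j)))"
        using sum_c_coeff_by_parts[of j r "\<lambda>i. (A ^^ i) (n - int j)" N] j by simp
      also have "\<dots> = (\<Sum>i=1..N. of_bool (j \<le> r i) * int (count i (N - j)))"
      proof (rule sum.cong)
        fix i assume i: "i \<in> {1..N}"
        have "j \<le> N" using j by simp
        then show "r_ind r i j * ((A ^^ i) (n - int j) - (A ^^ Suc i) (n - int j))
            = of_bool (j \<le> r i) * int (count i (N - j))"
          using i by (simp only: shift count_eq) (simp add: r_ind_pos)
      qed simp
      finally show "(\<Sum>i=1..N. ?t i j) = (\<Sum>i=1..N. of_bool (j \<le> r i) * int (count i (N - j)))" .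
    qed simp
    also have "\<dots> = (\<Sum>(i, j)\<in>{1..N} \<times> {1..N}. of_bool (j \<le> r i) * int (count i (N - j)))"
      by (simp only: sum.cartesian_product[symmetric]) (rule sum.swap)
    also have "\<dots> = (\<Sum>(i, j) | i \<in> {1..N} \<and> j \<in> {1..N} \<and> j \<le> r i. int (count i (N - j)))"
      by (rule sum.mono_neutral_cong_right) auto
    also have "\<dots> = int (\<Sum>(i, j) | i \<in> {1..N} \<and> j \<in> {1..N} \<and> j \<le> r i. count i (N - j))"
      by (simp add: of_nat_sum case_prod_unfold)
    \<comment> \<open>The two counts of the letters \<open>[0]\<close> meet: by blocks here, by
      complement to first children in the next step.\<close>
    also have "\<dots> = int (count 0 N) - int s"
      using count_0_eq_sum[OF N(2)] by simp
    also have "\<dots> = n - int s - A n"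
      using count_0[of N] by (simp add: N A_int)
    finally show ?thesis using fin by simp
  qed
  from small large show ?thesis unfolding A_def by blast
qed

end
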